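(* Let $v(0)\in\mathcal N^*$. Let $v(t)$ be either the solution of the subcritical equations with initial condition $v(0)$ (and some continuous rate function $\lambda$ bounded below by a positive constant), or the solution of the alternating equations with initial condition $v(0)$ (and some sequence of burning times), and let $\tilde v(t)$ be the solution of the critical equations with the same initial condition. Then for all $t\ge 1/m_1(0)$ and $k\ge1$, $$\tilde v_k(t)=v_k(t)e^{-k x^*(t)},\qquad\text{where } x^*(t):=\inf\Big\{x:\sum_{k=1}^\infty v_k(t)e^{-kx}<+\infty\Big\}.$$
   Context: $\mathcal N$: sequences $v=(v_k)_{k\ge1}$ of nonnegative reals with $\sum_kv_k<\infty$; $\mathcal N^*$: those with finitely many nonzero terms; $m_0=\sum_kv_k$, $m_1=\sum_kkv_k$. Subcritical equations with rate $\lambda$: $v(t)\in\mathcal N$, $v_k(t)=v_k(0)+\int_0^t\big(\tfrac k2\sum_{l=1}^{k-1}v_lv_{k-l}-kv_km_0(s)-\lambda(s)kv_k\big)ds$ for all $k$, with $\Phi(t)=m_0(0)-m_0(t)$ nondecreasing in $[0,m_0(0))$. Critical equations: the same with $\lambda\equiv0$. Alternating equations with burning times $0=\beta_0<\beta_1<\dots$ (no accumulation), $M(t)=\max\{i:\beta_i<t\}$: $\dot v_k(t)=\tfrac k2\sum_{l=1}^{k-1}v_lv_{k-l}-kv_km_0(\beta_{M(t)})$, $v_k$ continuous. All have unique solutions. *)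

theory Defs
  imports "HOL-Analysis.Analysis"
begin

text \<open>A state is a sequence u :: nat \<Rightarrow> real indexed by k \<ge> 1; the value at index 0 is ignored.\<close>

definition inN :: "(nat \<Rightarrow> real) \<Rightarrow> bool" where
  "inN u \<longleftrightarrow> (\<forall>k\<ge>1. u k \<ge> 0) \<and> summable (\<lambda>k. u (Suc k))"

definition inNstar :: "(nat \<Rightarrow> real) \<Rightarrow> bool" where
  "inNstar u \<longleftrightarrow> inN u \<and> finite {k. k \<ge> 1 \<and> u k \<noteq> 0}"

definition m0 :: "(nat \<Rightarrow> real) \<Rightarrow> real" where
  "m0 u = (\<Sum>k. u (Suc k))"

definition m1 :: "(nat \<Rightarrow> real) \<Rightarrow> real" where
  "m1 u = (\<Sum>k. real (Suc k) * u (Suc k))"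

definition coag :: "(nat \<Rightarrow> real) \<Rightarrow> nat \<Rightarrow> real" where
  "coag u k = real k / 2 * (\<Sum>l=1..k-1. u l * u (k - l))"

definition subcritical_sol :: "(real \<Rightarrow> real) \<Rightarrow> (real \<Rightarrow> nat \<Rightarrow> real) \<Rightarrow> bool" where
  "subcritical_sol lam v \<longleftrightarrow>
     (\<forall>t\<ge>0. inN (v t)) \<and>
     (\<forall>k\<ge>1. \<forall>t\<ge>0.
        ((\<lambda>s. coag (v s) k - real k * v s k * m0 (v s) - lam s * real k * v s k)
           has_integral (v t k - v 0 k)) {0..t}) \<and>
     mono_on {0..} (\<lambda>t. m0 (v 0) - m0 (v t)) \<and>
     (\<forall>t\<ge>0. 0 \<le> m0 (v 0) - m0 (v t) \<and> m0 (v 0) - m0 (v t) < m0 (v 0))"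

definition critical_sol :: "(real \<Rightarrow> nat \<Rightarrow> real) \<Rightarrow> bool" where
  "critical_sol v \<longleftrightarrow> subcritical_sol (\<lambda>_. 0) v"

definition burning_times :: "(nat \<Rightarrow> real) \<Rightarrow> bool" where
  "burning_times \<beta> \<longleftrightarrow> \<beta> 0 = 0 \<and> strict_mono \<beta> \<and> filterlim \<beta> at_top sequentially"

text \<open>Alternating equations: on (beta_i, beta_{i+1}) we have M(t) = i.\<close>
definition alternating_sol :: "(nat \<Rightarrow> real) \<Rightarrow> (real \<Rightarrow> nat \<Rightarrow> real) \<Rightarrow> bool" where
  "alternating_sol \<beta> v \<longleftrightarrow>
     (\<forall>t\<ge>0. inN (v t)) \<and>
     (\<forall>k\<ge>1. continuous_on {0..} (\<lambda>t. v t k)) \<and>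
     (\<forall>i k t. k \<ge> 1 \<and> \<beta> i < t \<and> t < \<beta> (Suc i) \<longrightarrow>
        ((\<lambda>s. v s k) has_real_derivative
           (coag (v t) k - real k * v t k * m0 (v (\<beta> i)))) (at t))"

definition xstar :: "(nat \<Rightarrow> real) \<Rightarrow> real" where
  "xstar u = Inf {x. summable (\<lambda>k. u (Suc k) * exp (- real (Suc k) * x))}"

end

theory Submission
  imports Defs "HOL-Computational_Algebra.Formal_Power_Series"
begin

text \<open>
  Writing \<open>v_k(t) = w_k(t) exp (- k a(t))\<close> with \<open>a\<close> the integral of the loss rate removes the loss
  terms: \<open>w\<close> solves \<open>w_k' = (k/2) \<Sum> w_l w_{k-l}\<close> and depends on \<open>v(0)\<close> only. So all the solutions differ
  by exponential factors, and the claim says that for \<open>t \<ge> 1/m_1(0)\<close> the exponent of the critical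
  solution is the abscissa of convergence \<open>X(t)\<close> of \<open>W(t,y) = \<Sum> w_k(t) exp (- k y)\<close>.

  \<open>W\<close> solves Burgers' equation, so the method of characteristics gives \<open>y = q + t W_0(q)\<close> with
  \<open>q = y - t W(t,y)\<close> and \<open>W(t,y) = W_0(q)\<close>. After time \<open>1/m_1(0)\<close> the map \<open>q \<mapsto> q + t W_0(q)\<close> has a minimum
  at some \<open>y_t\<close>; the series cannot converge below the minimal value \<open>X(t)\<close>. The critical exponent
  satisfies \<open>a' = W(t,a) \<le> W_0(y_t) = X'\<close>, \<open>a \<ge> X\<close>, and \<open>a \<le> X\<close> at \<open>t = 1/m_1(0)\<close>, whence \<open>a = X\<close>.
\<close>

subsection \<open>Coagulation flows\<close>

text \<open>A level \<open>c\<close> outside the countable image of \<open>S\<close> is last attained at a point where \<open>f\<close> is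
  differentiable (after tilting \<open>f\<close> to make the slope strictly negative).\<close>

lemma antimono_off_countable:
  fixes f :: "real \<Rightarrow> real"
  assumes "a \<le> b" and cont: "continuous_on {a..b} f" and S: "countable S"
    and deriv: "\<And>t. t \<in> {a<..<b} - S \<Longrightarrow> (f has_real_derivative f' t) (at t)"
    and f': "\<And>t. t \<in> {a<..<b} - S \<Longrightarrow> f' t \<le> 0"
  shows "f b \<le> f a"
proof (rule ccontr)
  assume "\<not> f b \<le> f a"
  then have less: "f a < f b" and "a < b" using \<open>a \<le> b\<close> by (auto simp: order_le_less)
  define e where "e = (f b - f a) / (2 * (b - a))"
  have e: "e > 0" using less \<open>a < b\<close> by (simp add: e_def)
  define g where "g x = f x - e * (x - a)" for x
  have eb: "e * (b - a) = (f b - f a) / 2" using \<open>a < b\<close> unfolding e_def by (simp add: divide_simps)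
  have "g a < g b" using less by (simp add: g_def eb field_simps)
  moreover have "countable (g ` S)" using S by simp
  ultimately obtain c where c: "c \<in> {g a<..<g b}" "c \<notin> g ` S"
    by (metis countable_subset subsetI uncountable_open_interval)
  have contg: "continuous_on {a..b} g"
    unfolding g_def by (intro continuous_intros cont)
  define Z where "Z = {x \<in> {a..b}. g x \<le> c}"
  have "closed Z"
    unfolding Z_def by (intro continuous_on_closed_Collect_le contg continuous_intros)
  have "a \<in> Z" using c \<open>a < b\<close> by (auto simp: Z_def)
  have bdd: "bdd_above Z" by (rule bdd_aboveI[of _ b]) (auto simp: Z_def)
  define x where "x = Sup Z"
  have "x \<in> Z"
    unfolding x_def using \<open>a \<in> Z\<close> bdd \<open>closed Z\<close> closed_contains_Sup by blast
  then have x: "a \<le> x" "x \<le> b" "g x \<le> c" by (auto simp: Z_def)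
  have right: "g y > c" if "x < y" "y \<le> b" for y
  proof (rule ccontr)
    assume "\<not> g y > c"
    then have "y \<in> Z" using that x by (auto simp: Z_def)
    then show False using cSup_upper[OF _ bdd, of y] that by (simp add: x_def)
  qed
  have "x < b" using x c by (metis greaterThanLessThan_iff linorder_not_less order_le_less)
  have "g x = c"
  proof (rule ccontr)
    assume "g x \<noteq> c"
    then have "g x < c" using x by simp
    moreover have "continuous_on {x..b} g" using contg x by (auto intro: continuous_on_subset)
    ultimately obtain y where "x \<le> y" "y \<le> b" "g y = c"
      using IVT'[of g x c b] c x by auto
    then show False using right[of y] \<open>g x \<noteq> c\<close> by (cases "x = y") auto
  qed
  then have "x \<notin> S" "x \<noteq> a" using c by auto
  then have x_in: "x \<in> {a<..<b} - S" using x \<open>x < b\<close> by auto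
  then have "(g has_real_derivative f' x - e) (at x)"
    unfolding g_def by (auto intro!: derivative_eq_intros deriv)
  moreover have "f' x - e < 0" using f'[OF x_in] e by simp
  ultimately obtain d where d: "d > 0" "\<And>h. h > 0 \<Longrightarrow> h < d \<Longrightarrow> g (x + h) < g x"
    using DERIV_neg_dec_right by blast
  define h where "h = min (d / 2) (b - x)"
  have "h > 0" "h < d" "x + h \<le> b" using d \<open>x < b\<close> by (auto simp: h_def)
  then show False using d(2)[of h] right[of "x + h"] \<open>g x = c\<close> by auto
qed

lemma const_off_countable:
  fixes f :: "real \<Rightarrow> real"
  assumes "a \<le> b" "continuous_on {a..b} f" "countable S"
    and "\<And>t. t \<in> {a<..<b} - S \<Longrightarrow> (f has_real_derivative 0) (at t)"
  shows "f b = f a"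
proof (rule antisym)
  show "f b \<le> f a"
    using assms by (intro antimono_off_countable[of a b f S "\<lambda>_. 0"]) auto
  have "- f b \<le> - f a"
    using assms by (intro antimono_off_countable[of a b "\<lambda>x. - f x" S "\<lambda>_. 0"])
      (auto intro!: continuous_intros derivative_eq_intros)
  then show "f a \<le> f b" by simp
qed

text \<open>\<open>S\<close> holds the times at which the loss rate may jump: \<open>m0\<close> of a
  subcritical solution is monotone, so its continuity is only guaranteed off a countable
  set.\<close>

definition coag_flow :: "real set \<Rightarrow> real \<Rightarrow> real \<Rightarrow> (real \<Rightarrow> nat \<Rightarrow> real) \<Rightarrow> bool" where
  "coag_flow S a b h \<longleftrightarrow>
     (\<forall>k\<ge>1. continuous_on {a..b} (\<lambda>t. h t k)) \<and>
     (\<forall>k\<ge>1. \<forall>t\<in>{a<..<b} - S. ((\<lambda>s. h s k) has_real_derivative coag (h t) k) (at t))"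

lemma coag_cong: "(\<And>l. 1 \<le> l \<Longrightarrow> l < k \<Longrightarrow> u l = w l) \<Longrightarrow> coag u k = coag w k"
  unfolding coag_def by (intro arg_cong[where f = "(*) _"] sum.cong refl arg_cong2[where f = "(*)"]) auto

text \<open>The system is triangular: \<open>coag u k\<close> involves only the indices from 1 to
  \<open>k - 1\<close>, so by strong induction on \<open>k\<close> both flows have equal derivatives
  off the two exceptional sets.\<close>

lemma coag_flow_unique:
  assumes g: "coag_flow S a b g" and h: "coag_flow S' a b h"
    and S: "countable S" "countable S'" and init: "\<And>k. k \<ge> 1 \<Longrightarrow> g a k = h a k"
    and "t \<in> {a..b}" "k \<ge> 1"
  shows "g t k = h t k"
  using assms(6,7)
proof (induction k arbitrary: t rule: less_induct)
  case (less k)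
  have "g t k - h t k = g a k - h a k"
  proof (rule const_off_countable[where f = "\<lambda>t. g t k - h t k" and S = "S \<union> S'"])
    show "continuous_on {a..t} (\<lambda>t. g t k - h t k)"
      using g h less.prems unfolding coag_flow_def
      by (intro continuous_intros) (auto intro: continuous_on_subset)
    fix s assume s: "s \<in> {a<..<t} - (S \<union> S')"
    then have "coag (g s) k = coag (h s) k"
      using less.IH less.prems by (intro coag_cong) auto
    moreover have "((\<lambda>s. g s k) has_real_derivative coag (g s) k) (at s)"
        "((\<lambda>s. h s k) has_real_derivative coag (h s) k) (at s)"
      using g h s less.prems unfolding coag_flow_def by auto
    ultimately show "((\<lambda>s. g s k - h s k) has_real_derivative 0) (at s)"
      by (auto intro!: derivative_eq_intros)
  qed (use S less.prems in auto)
  then show ?case using init less.prems by simp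
qed

lemma continuous_on_coag:
  assumes "\<And>k. k \<ge> 1 \<Longrightarrow> continuous_on A (\<lambda>t. h t k)"
  shows "continuous_on A (\<lambda>t. coag (h t) k)"
  unfolding coag_def by (intro continuous_intros assms) auto

text \<open>The integral of the continuous function \<open>coag (h s) k\<close> is differentiable
  everywhere and differs from \<open>h s k\<close> by a constant, so the exceptional times
  disappear.\<close>

lemma coag_flow_deriv_within:
  assumes h: "coag_flow S a b h" and S: "countable S" and "t \<in> {a..b}" "k \<ge> 1"
  shows "((\<lambda>s. h s k) has_real_derivative coag (h t) k) (at t within {a..b})"
proof -
  define c where "c = (\<lambda>s. coag (h s) k)"
  have c: "continuous_on {a..b} c"
    unfolding c_def using h by (intro continuous_on_coag) (auto simp: coag_flow_def)
  define I where "I s = integral {a..s} c" for s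
  have I: "(I has_real_derivative c s) (at s within {a..b})" if "s \<in> {a..b}" for s
    unfolding I_def using integral_has_real_derivative[OF c that] .
  have eq: "h s k = I s + h a k" if s: "s \<in> {a..b}" for s
  proof -
    have "h s k - I s = h a k - I a"
    proof (rule const_off_countable[where f = "\<lambda>s. h s k - I s", OF _ _ S])
      have "continuous_on {a..b} I"
        using I by (rule DERIV_continuous_on)
      then show "continuous_on {a..s} (\<lambda>s. h s k - I s)"
        using h s \<open>k \<ge> 1\<close> unfolding coag_flow_def
        by (intro continuous_intros) (auto intro: continuous_on_subset)
      fix r assume r: "r \<in> {a<..<s} - S"
      then have "(I has_real_derivative c r) (at r)"
        using I[of r] s at_within_Icc_at[of a r b] by auto
      moreover have "((\<lambda>s. h s k) has_real_derivative c r) (at r)"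
        using h r s \<open>k \<ge> 1\<close> unfolding coag_flow_def c_def by auto
      ultimately show "((\<lambda>s. h s k - I s) has_real_derivative 0) (at r)"
        by (auto intro!: derivative_eq_intros)
    qed (use s in auto)
    then show ?thesis by (simp add: I_def)
  qed
  have "((\<lambda>s. I s + h a k) has_real_derivative c t) (at t within {a..b})"
    using DERIV_add[OF I[OF \<open>t \<in> _\<close>] DERIV_const[of "h a k"]] by simp
  then have "((\<lambda>s. h s k) has_real_derivative c t) (at t within {a..b})"
    by (rule has_field_derivative_transform_within[where d = 1])
      (use \<open>t \<in> _\<close> eq[symmetric] in auto)
  then show ?thesis by (simp add: c_def)
qed

lemma coag_exp: "coag (\<lambda>k. u k * exp (real k * x)) k = coag u k * exp (real k * x)"
proof -
  have "u l * exp (real l * x) * (u (k - l) * exp (real (k - l) * x)) = u l * u (k - l) * exp (real k * x)"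
    if "l \<in> {1..k-1}" for l
  proof -
    have "exp (real k * x) = exp (real l * x) * exp (real (k - l) * x)"
      using that by (auto simp: exp_add[symmetric] of_nat_diff algebra_simps)
    then show ?thesis by simp
  qed
  then show ?thesis
    unfolding coag_def mult.assoc[of "real k / 2"] sum_distrib_right
    by (intro arg_cong[where f = "(*) _"] sum.cong refl)
qed

text \<open>The integrating factor absorbs the loss terms, so the flow no longer sees the rate \<open>\<mu>\<close>:
  all the equations have the same solution up to a factor of the form \<open>exp (- k a)\<close>.\<close>

lemma coag_flow_integrating_factor:
  assumes v: "\<And>k. k \<ge> 1 \<Longrightarrow> continuous_on {a..b} (\<lambda>t. v t k)" and A: "continuous_on {a..b} A"
    and dv: "\<And>k t. k \<ge> 1 \<Longrightarrow> t \<in> {a<..<b} - S \<Longrightarrow>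
      ((\<lambda>s. v s k) has_real_derivative coag (v t) k - real k * v t k * \<mu> t) (at t)"
    and dA: "\<And>t. t \<in> {a<..<b} - S \<Longrightarrow> (A has_real_derivative \<mu> t) (at t)"
  shows "coag_flow S a b (\<lambda>t k. v t k * exp (real k * A t))"
  unfolding coag_flow_def
proof (intro conjI allI impI ballI)
  fix k :: nat assume k: "k \<ge> 1"
  show "continuous_on {a..b} (\<lambda>t. v t k * exp (real k * A t))"
    by (intro continuous_intros v A k)
  fix t assume t: "t \<in> {a<..<b} - S"
  show "((\<lambda>s. v s k * exp (real k * A s)) has_real_derivative
      coag (\<lambda>k. v t k * exp (real k * A t)) k) (at t)"
    unfolding coag_exp
    by (rule derivative_eq_intros dv[OF k t] dA[OF t] refl)+ (simp add: algebra_simps)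
qed

text \<open>Monotonicity makes \<open>m0 (v t)\<close> integrable, and continuous off a countable
  set that does not depend on \<open>T\<close>. At the continuity points the integral equation can
  be differentiated.\<close>

lemma subcritical_flow:
  assumes sol: "subcritical_sol lam v" and lam: "continuous_on {0..} lam"
  defines "A \<equiv> \<lambda>t. integral {0..t} (\<lambda>s. m0 (v s) + lam s)"
  obtains S where "countable S" "\<And>T. coag_flow S 0 T (\<lambda>t k. v t k * exp (real k * A t))"
proof -
  define \<mu> where "\<mu> = (\<lambda>s. m0 (v s) + lam s)"
  have mono: "mono_on {0..} (\<lambda>t. m0 (v 0) - m0 (v t))"
    using sol by (simp add: subcritical_sol_def)
  define S where "S = {a\<in>{0..}. \<not> continuous (at a within {0..}) (\<lambda>t. m0 (v 0) - m0 (v t))}"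
  have "countable S" unfolding S_def by (rule mono_on_ctble_discont[OF mono])
  have "(\<lambda>t. m0 (v 0) - m0 (v t)) integrable_on {0..T}" for T
    using mono by (intro integrable_on_mono_on) (auto simp: mono_on_def)
  from integrable_diff[OF integrable_const_ivl this, of "m0 (v 0)"]
  have "(\<lambda>t. m0 (v t)) integrable_on {0..T}" for T by simp
  moreover have "lam integrable_on {0..T}" for T
    using lam by (intro integrable_continuous_real) (auto intro: continuous_on_subset)
  ultimately have int\<mu>: "\<mu> integrable_on {0..T}" for T
    unfolding \<mu>_def by (rule integrable_add)
  have cont\<mu>: "isCont \<mu> t" if "t > 0" "t \<notin> S" for t
  proof -
    have t: "t \<in> interior {0..}" using that by simp
    have "isCont (\<lambda>t. m0 (v 0) - m0 (v t)) t"
      using that at_within_interior[OF t] by (auto simp: S_def)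
    from continuous_diff[OF continuous_const this, of "m0 (v 0)"]
    have "isCont (\<lambda>t. m0 (v t)) t" by simp
    moreover have "isCont lam t" using lam t continuous_on_interior by blast
    ultimately show ?thesis unfolding \<mu>_def by (intro continuous_intros) simp_all
  qed
  have deriv: "((\<lambda>u. integral {0..u} f) has_real_derivative f t) (at t)"
    if "t > 0" "isCont f t" "\<And>T. f integrable_on {0..T}" for f :: "real \<Rightarrow> real" and t
    using integral_has_vector_derivative_continuous_at[of f 0 "t + 1" t "{}"] that
      at_within_Icc_at[of 0 t "t + 1"]
    by (auto simp: has_real_derivative_iff_has_vector_derivative continuous_at_imp_continuous_at_within)
  define f where "f k = (\<lambda>s. coag (v s) k - real k * v s k * m0 (v s) - lam s * real k * v s k)" for k
  have hi: "(f k has_integral (v t k - v 0 k)) {0..t}" if "k \<ge> 1" "t \<ge> 0" for k t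
    using sol that by (simp add: subcritical_sol_def f_def)
  have intf: "f k integrable_on {0..T}" if "k \<ge> 1" for k T
    using hi[OF that, of T] by (cases "T \<ge> 0") auto
  have veq: "v t k = v 0 k + integral {0..t} (f k)" if "k \<ge> 1" "t \<ge> 0" for k t
    using integral_unique[OF hi[OF that]] by simp
  have contv: "continuous_on {0..T} (\<lambda>t. v t k)" if "k \<ge> 1" for k T
  proof -
    have "continuous_on {0..T} (\<lambda>t. v 0 k + integral {0..t} (f k))"
      by (intro continuous_intros indefinite_integral_continuous_1 intf that)
    then show ?thesis by (rule continuous_on_eq) (use veq[OF that, symmetric] in auto)
  qed
  have isCont_v: "isCont (\<lambda>t. v t k) t" if "k \<ge> 1" "t > 0" for k t
    using contv[OF that(1), of "t + 1"] that(2)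
    by (intro continuous_on_interior[of "{0..t+1}"]) auto
  have dv: "((\<lambda>s. v s k) has_real_derivative coag (v t) k - real k * v t k * \<mu> t) (at t)"
    if "k \<ge> 1" "t > 0" "t \<notin> S" for k t
  proof -
    have "isCont (\<lambda>s. coag (v s) k - real k * v s k * \<mu> s) t"
      unfolding coag_def using that by (intro continuous_intros isCont_v cont\<mu>) auto
    moreover have f: "f k = (\<lambda>s. coag (v s) k - real k * v s k * \<mu> s)"
      by (auto simp: f_def \<mu>_def algebra_simps)
    ultimately have "isCont (f k) t" by (simp only:)
    then have "((\<lambda>u. integral {0..u} (f k)) has_real_derivative f k t) (at t)"
      by (intro deriv intf that)
    then have "((\<lambda>u. v 0 k + integral {0..u} (f k)) has_real_derivative f k t) (at t)"
      using DERIV_add[OF DERIV_const[of "v 0 k"]] by fastforce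
    then have "((\<lambda>s. v s k) has_real_derivative f k t) (at t)"
      by (rule has_field_derivative_transform_within_open[where S = "{0<..}"])
        (use that veq[OF that(1), symmetric] in auto)
    then show ?thesis by (simp add: f)
  qed
  have "coag_flow S 0 T (\<lambda>t k. v t k * exp (real k * A t))" for T
  proof (rule coag_flow_integrating_factor[where \<mu> = \<mu>])
    show "continuous_on {0..T} A"
      unfolding A_def \<mu>_def[symmetric] by (intro indefinite_integral_continuous_1 int\<mu>)
    show "(A has_real_derivative \<mu> t) (at t)" if "t \<in> {0<..<T} - S" for t
      using that unfolding A_def \<mu>_def[symmetric] by (intro deriv cont\<mu> int\<mu>) auto
  qed (use contv dv in auto)
  with \<open>countable S\<close> show thesis by (rule that)
qed

text \<open>Between consecutive burning times the loss rate is constant, so the exponent is affine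
  there, and the relation to \<open>h\<close> passes from one burning time to the next.\<close>

lemma alternating_flow:
  assumes \<beta>: "burning_times \<beta>" and sol: "alternating_sol \<beta> v"
    and h: "\<And>T. coag_flow S 0 T h" "countable S" and init: "\<And>k. k \<ge> 1 \<Longrightarrow> h 0 k = v 0 k"
    and "t \<ge> 0"
  shows "\<exists>a. \<forall>k\<ge>1. v t k = h t k * exp (- real k * a)"
proof -
  have smono: "strict_mono \<beta>" and "\<beta> 0 = 0" and lim: "filterlim \<beta> at_top sequentially"
    using \<beta> by (auto simp: burning_times_def)
  have nonneg: "\<beta> i \<ge> 0" for i
    using strict_mono_less_eq[OF smono, of 0 i] \<open>\<beta> 0 = 0\<close> by simp
  have step: "\<exists>a'. \<forall>k\<ge>1. v s k = h s k * exp (- real k * a')"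
    if a: "\<forall>k\<ge>1. v (\<beta> i) k = h (\<beta> i) k * exp (- real k * a)" and s: "s \<in> {\<beta> i..\<beta> (Suc i)}" for a i s
  proof -
    define A where "A r = a + m0 (v (\<beta> i)) * (r - \<beta> i)" for r
    have "coag_flow {} (\<beta> i) (\<beta> (Suc i)) (\<lambda>t k. v t k * exp (real k * A t))"
    proof (rule coag_flow_integrating_factor[where \<mu> = "\<lambda>_. m0 (v (\<beta> i))"])
      show "continuous_on {\<beta> i..\<beta> (Suc i)} (\<lambda>t. v t k)" if "k \<ge> 1" for k
        using sol that nonneg[of i] unfolding alternating_sol_def
        by (meson atLeast_iff atLeastAtMost_iff continuous_on_subset order_trans subsetI)
      show "((\<lambda>s. v s k) has_real_derivative coag (v t) k - real k * v t k * m0 (v (\<beta> i))) (at t)"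
        if "k \<ge> 1" "t \<in> {\<beta> i<..<\<beta> (Suc i)} - {}" for k t
        using sol that unfolding alternating_sol_def by auto
      show "(A has_real_derivative m0 (v (\<beta> i))) (at t)" for t
        unfolding A_def by (auto intro!: derivative_eq_intros)
    qed (auto simp: A_def intro!: continuous_intros)
    moreover have "coag_flow S (\<beta> i) (\<beta> (Suc i)) h"
      using h(1)[of "\<beta> (Suc i)"] nonneg[of i] unfolding coag_flow_def
      by (auto intro: continuous_on_subset)
    moreover have "v (\<beta> i) k * exp (real k * A (\<beta> i)) = h (\<beta> i) k" if "k \<ge> 1" for k
      using a that by (simp add: A_def exp_minus)
    ultimately have "v s k * exp (real k * A s) = h s k" if "k \<ge> 1" for k
      using coag_flow_unique[of "{}" "\<beta> i" "\<beta> (Suc i)" _ S h s k] s h(2) that by auto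
    then have "v s k = h s k * exp (- real k * A s)" if "k \<ge> 1" for k
      using that by (metis exp_minus_inverse mult.assoc mult.right_neutral mult_minus_left)
    then show ?thesis by blast
  qed
  have grid: "\<exists>a. \<forall>k\<ge>1. v (\<beta> i) k = h (\<beta> i) k * exp (- real k * a)" for i
  proof (induction i)
    case 0
    show ?case using init \<open>\<beta> 0 = 0\<close> by (intro exI[of _ 0]) simp
  next
    case (Suc i)
    then show ?case using step[of i _ "\<beta> (Suc i)"] strict_monoD[OF smono, of i "Suc i"] by auto
  qed
  obtain n where n: "\<beta> n > t"
    using lim unfolding filterlim_at_top_dense eventually_sequentially by blast
  \<comment> \<open>The first burning time after \<open>t\<close>; it is not
    \<open>\<beta> 0\<close>, so its predecessor starts an interval containing
    \<open>t\<close>.\<close>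
  define m where "m = (LEAST n. \<beta> n > t)"
  have m: "\<beta> m > t" unfolding m_def using n by (rule LeastI)
  then obtain i where i: "m = Suc i" using \<open>t \<ge> 0\<close> \<open>\<beta> 0 = 0\<close> by (cases m) auto
  then have "\<beta> i \<le> t" using not_less_Least[of i "\<lambda>n. \<beta> n > t"] unfolding m_def by force
  then show ?thesis using grid[of i] step[of i _ t] m i by auto
qed

subsection \<open>Burgers transport of formal power series\<close>

text \<open>Differentiation is coefficientwise, so no convergence question arises: each coefficient
  of a product is a finite sum.\<close>

definition fps_curve_deriv :: "(real \<Rightarrow> real fps) \<Rightarrow> real fps \<Rightarrow> real \<Rightarrow> real set \<Rightarrow> bool" where
  "fps_curve_deriv G G' t X \<longleftrightarrow>
     (\<forall>k. ((\<lambda>s. fps_nth (G s) k) has_real_derivative fps_nth G' k) (at t within X))"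

lemma fps_curve_deriv_const: "fps_curve_deriv (\<lambda>_. f) 0 t X"
  by (simp add: fps_curve_deriv_def)

lemma fps_curve_deriv_fps_const:
  "(c has_real_derivative c') (at t within X) \<Longrightarrow>
    fps_curve_deriv (\<lambda>s. fps_const (c s)) (fps_const c') t X"
  by (simp add: fps_curve_deriv_def)

lemma fps_curve_deriv_add:
  "fps_curve_deriv G G' t X \<Longrightarrow> fps_curve_deriv H H' t X \<Longrightarrow>
    fps_curve_deriv (\<lambda>s. G s + H s) (G' + H') t X"
  unfolding fps_curve_deriv_def by (auto intro!: derivative_eq_intros)

lemma fps_curve_deriv_diff:
  "fps_curve_deriv G G' t X \<Longrightarrow> fps_curve_deriv H H' t X \<Longrightarrow>
    fps_curve_deriv (\<lambda>s. G s - H s) (G' - H') t X"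
  unfolding fps_curve_deriv_def by (auto intro!: derivative_eq_intros)

lemma fps_curve_deriv_mult:
  assumes "fps_curve_deriv G G' t X" "fps_curve_deriv H H' t X"
  shows "fps_curve_deriv (\<lambda>s. G s * H s) (G' * H t + G t * H') t X"
  unfolding fps_curve_deriv_def
proof
  fix k
  have "((\<lambda>s. \<Sum>i=0..k. fps_nth (G s) i * fps_nth (H s) (k - i)) has_real_derivative
      (\<Sum>i=0..k. fps_nth G' i * fps_nth (H t) (k - i) + fps_nth H' (k - i) * fps_nth (G t) i)) (at t within X)"
    using assms unfolding fps_curve_deriv_def by (intro DERIV_sum DERIV_mult) auto
  then show "((\<lambda>s. fps_nth (G s * H s) k) has_real_derivative
      fps_nth (G' * H t + G t * H') k) (at t within X)"
    by (simp add: fps_mult_nth sum.distrib mult.commute[of "fps_nth H' _"])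
qed

lemma fps_curve_deriv_power:
  assumes "fps_curve_deriv G G' t X"
  shows "fps_curve_deriv (\<lambda>s. G s ^ Suc n) (of_nat (Suc n) * G t ^ n * G') t X"
proof (induction n)
  case 0
  then show ?case using assms by simp
next
  case (Suc n)
  show ?case
    using fps_curve_deriv_mult[OF assms Suc] by (simp add: algebra_simps)
qed

lemma fps_compose_nth_le:
  assumes "fps_nth b 0 = (0 :: 'a :: idom)" "n \<le> N"
  shows "fps_nth (a oo b) n = (\<Sum>i\<le>N. fps_nth a i * fps_nth (b ^ i) n)"
  unfolding fps_compose_nth atMost_atLeast0
  using startsby_zero_power_prefix[OF assms(1)] assms(2) by (intro sum.mono_neutral_left) auto

text \<open>The composition is the series exp(s F(s)). Up to degree \<open>N\<close> it agrees with
  the partial sum \<open>T N s\<close>, so differentiating the partial sums suffices.\<close>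

lemma fps_curve_deriv_exp:
  assumes F: "fps_curve_deriv F F' t X" and F0: "\<And>s. fps_nth (F s) 0 = 0"
  shows "fps_curve_deriv (\<lambda>s. fps_exp s oo F s) ((F t + fps_const t * F') * (fps_exp t oo F t)) t X"
proof -
  define T where "T N s = (\<Sum>n\<le>N. fps_const (s ^ n / fact n) * F s ^ n)" for N s
  have E: "fps_nth (fps_exp s oo F s) k = fps_nth (T N s) k" if "k \<le> N" for k N s
    using fps_compose_nth_le[OF F0 that] by (simp add: T_def fps_sum_nth)
  have term_deriv: "fps_curve_deriv (\<lambda>s. fps_const (s ^ Suc n / fact (Suc n)) * F s ^ Suc n)
      ((F t + fps_const t * F') * (fps_const (t ^ n / fact n) * F t ^ n)) t X" for n
  proof -
    let ?d = "t ^ Suc n / fact (Suc n) :: real" and ?c = "t ^ n / fact n :: real"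
    have "((\<lambda>s. s ^ Suc n / fact (Suc n)) has_real_derivative (real (Suc n) * t ^ n) / fact (Suc n)) (at t within X)"
      by (rule derivative_eq_intros refl | simp)+
    moreover have "(real (Suc n) * t ^ n) / fact (Suc n) = ?c"
      by (simp del: of_nat_Suc)
    ultimately have d: "((\<lambda>s. s ^ Suc n / fact (Suc n)) has_real_derivative ?c) (at t within X)"
      by simp
    have "?d * real (Suc n) = t * ?c"
      by (simp del: of_nat_Suc)
    then have "fps_const ?d * of_nat (Suc n) = fps_const t * fps_const ?c"
      unfolding fps_of_nat[symmetric] fps_const_mult by (rule arg_cong)
    then have eq: "fps_const ?d * (of_nat (Suc n) * F t ^ n * F') = fps_const t * fps_const ?c * F t ^ n * F'"
      by (simp only: mult.assoc[symmetric])
    have eq': "fps_const ?c * F t ^ Suc n + fps_const t * fps_const ?c * F t ^ n * F' =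
        (F t + fps_const t * F') * (fps_const ?c * F t ^ n)"
      by (simp only: power_Suc distrib_left distrib_right mult_ac)
    show ?thesis
      using fps_curve_deriv_mult[OF fps_curve_deriv_fps_const[OF d] fps_curve_deriv_power[OF F, of n]]
      unfolding eq eq' .
  qed
  \<comment> \<open>Differentiation lowers the cutoff by one; starting from \<open>Suc k\<close>,
    the resulting \<open>T k t\<close> is still exact up to degree \<open>k\<close>.\<close>
  have T: "fps_curve_deriv (T (Suc N)) ((F t + fps_const t * F') * T N t) t X" for N
  proof (induction N)
    case 0
    show ?case
      using fps_curve_deriv_add[OF fps_curve_deriv_const[of 1] term_deriv[of 0]] by (simp add: T_def[abs_def])
  next
    case (Suc N)
    have step: "T (Suc (Suc N)) = (\<lambda>s. T (Suc N) s + fps_const (s ^ Suc (Suc N) / fact (Suc (Suc N))) * F s ^ Suc (Suc N))"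
      by (simp add: T_def[abs_def] fun_eq_iff)
    have step': "T (Suc N) t = T N t + fps_const (t ^ Suc N / fact (Suc N)) * F t ^ Suc N"
      by (simp add: T_def)
    show ?case
      unfolding step step' distrib_left by (rule fps_curve_deriv_add[OF Suc term_deriv])
  qed
  show ?thesis
    unfolding fps_curve_deriv_def
  proof
    fix k
    have "((\<lambda>s. fps_nth (T (Suc k) s) k) has_real_derivative
        fps_nth ((F t + fps_const t * F') * T k t) k) (at t within X)"
      using T[of k] by (simp add: fps_curve_deriv_def)
    moreover have "fps_nth ((F t + fps_const t * F') * T k t) k =
        fps_nth ((F t + fps_const t * F') * (fps_exp t oo F t)) k"
      unfolding fps_mult_nth by (intro sum.cong refl arg_cong2[where f = "(*)"]) (simp add: E[of _ k])
    ultimately show "((\<lambda>s. fps_nth (fps_exp s oo F s) k) has_real_derivative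
        fps_nth ((F t + fps_const t * F') * (fps_exp t oo F t)) k) (at t within X)"
      by (simp add: E[of k "Suc k"])
  qed
qed

text \<open>The Euler operator z d/dz, which is - d/dy for z = exp(-y); hence F_t = F
  \<open>theta\<close> F is Burgers' equation F_t + F F_y = 0.\<close>

definition theta :: "real fps \<Rightarrow> real fps" where
  "theta f = fps_X * fps_deriv f"

lemma theta_nth: "fps_nth (theta f) k = real k * fps_nth f k"
  by (cases k) (auto simp: theta_def)

lemma theta_mult: "theta (f * g) = theta f * g + f * theta g"
  by (simp add: theta_def algebra_simps)

text \<open>Formally, \<open>G\<close> is constant along the characteristics of the velocity field
  \<open>F\<close>. As \<open>theta\<close> is a derivation, polynomials in transported series are
  transported.\<close>

definition transported :: "(real \<Rightarrow> real fps) \<Rightarrow> real set \<Rightarrow> (real \<Rightarrow> real fps) \<Rightarrow> bool" where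
  "transported F X G \<longleftrightarrow> (\<forall>t\<in>X. fps_curve_deriv G (F t * theta (G t)) t X)"

lemma transported_const: "transported F X (\<lambda>_. fps_const c)"
  using fps_curve_deriv_const by (auto simp: transported_def theta_def)

lemma transported_add:
  "transported F X G \<Longrightarrow> transported F X H \<Longrightarrow> transported F X (\<lambda>t. G t + H t)"
  using fps_curve_deriv_add[of G "F t * theta (G t)" t X H "F t * theta (H t)" for t]
  by (simp add: transported_def theta_def algebra_simps)

lemma transported_diff:
  "transported F X G \<Longrightarrow> transported F X H \<Longrightarrow> transported F X (\<lambda>t. G t - H t)"
  using fps_curve_deriv_diff[of G "F t * theta (G t)" t X H "F t * theta (H t)" for t]
  by (simp add: transported_def theta_def algebra_simps)

lemma transported_mult:
  assumes "transported F X G" "transported F X H"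
  shows "transported F X (\<lambda>t. G t * H t)"
  unfolding transported_def
proof
  fix t assume "t \<in> X"
  then have "fps_curve_deriv (\<lambda>t. G t * H t)
      (F t * theta (G t) * H t + G t * (F t * theta (H t))) t X"
    using assms unfolding transported_def by (intro fps_curve_deriv_mult) auto
  then show "fps_curve_deriv (\<lambda>t. G t * H t) (F t * theta (G t * H t)) t X"
    by (simp add: theta_mult algebra_simps)
qed

lemma transported_power:
  assumes "transported F X G"
  shows "transported F X (\<lambda>t. G t ^ n)"
proof (induction n)
  case 0
  show ?case using transported_const[of F X 1] by simp
next
  case (Suc n)
  show ?case using transported_mult[OF assms Suc] by simp
qed

lemma transported_sum:
  assumes "finite I" "\<And>i. i \<in> I \<Longrightarrow> transported F X (G i)"
  shows "transported F X (\<lambda>t. \<Sum>i\<in>I. G i t)"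
  using assms
proof (induction I rule: finite_induct)
  case empty
  show ?case using transported_const[of F X 0] by simp
next
  case (insert i I)
  then have "transported F X (\<lambda>t. G i t + (\<Sum>i\<in>I. G i t))"
    by (intro transported_add) auto
  then show ?case using insert.hyps by simp
qed

text \<open>Since \<open>F t\<close> has no constant term, coefficient \<open>k\<close> of
  \<open>F t * theta (G t)\<close> involves only lower coefficients of \<open>G t\<close>; once
  these vanish, coefficient \<open>k\<close> is constant in time.\<close>

lemma transported_zero:
  assumes G: "transported F {0..T} G" and F0: "\<And>s. fps_nth (F s) 0 = 0"
    and init: "G 0 = 0" and t: "t \<in> {0..T}"
  shows "G t = 0"
proof (rule fps_ext)
  fix k
  show "fps_nth (G t) k = fps_nth 0 k"
    using t
  proof (induction k arbitrary: t rule: less_induct)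
    case (less k)
    have "((\<lambda>s. fps_nth (G s) k) has_real_derivative 0) (at s within {0..T})" if s: "s \<in> {0..T}" for s
    proof -
      have "fps_nth (F s) i * fps_nth (theta (G s)) (k - i) = 0" if "i \<le> k" for i
        using less.IH[OF _ s, of "k - i"] F0 that by (cases "i = 0") (auto simp: theta_nth)
      then have "fps_nth (F s * theta (G s)) k = 0"
        by (auto simp: fps_mult_nth intro!: sum.neutral)
      then show ?thesis
        using G s unfolding transported_def fps_curve_deriv_def by metis
    qed
    then obtain c where "\<And>s. s \<in> {0..T} \<Longrightarrow> fps_nth (G s) k = c"
      using has_field_derivative_zero_constant[of "{0..T}" "\<lambda>s. fps_nth (G s) k"] by auto
    then have "fps_nth (G t) k = fps_nth (G 0) k" using less.prems by simp
    then show ?case using init by simp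
  qed
qed

text \<open>With z = exp(-y) this series is exp(-(y - t F)), a function of the foot of the
  characteristic.\<close>

lemma transported_X_exp:
  assumes F: "transported F X F" and F0: "\<And>s. fps_nth (F s) 0 = 0"
  shows "transported F X (\<lambda>t. fps_X * (fps_exp t oo F t))"
  unfolding transported_def
proof
  fix t assume t: "t \<in> X"
  let ?E = "fps_exp t oo F t"
  have "fps_curve_deriv (\<lambda>t. fps_X * (fps_exp t oo F t))
     (0 * ?E + fps_X * ((F t + fps_const t * (F t * theta (F t))) * ?E)) t X"
    using F F0 t unfolding transported_def
    by (intro fps_curve_deriv_mult fps_curve_deriv_exp fps_curve_deriv_const) auto
  moreover have "theta ?E = fps_const t * ?E * theta (F t)"
    unfolding theta_def fps_compose_deriv[OF F0] fps_exp_deriv fps_const_mult_apply_left[symmetric]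
    by (simp add: algebra_simps)
  then have "theta (fps_X * ?E) = fps_X * ?E + fps_X * (fps_const t * ?E * theta (F t))"
    by (simp add: theta_mult) (simp add: theta_def)
  ultimately show "fps_curve_deriv (\<lambda>t. fps_X * (fps_exp t oo F t))
      (F t * theta (fps_X * ?E)) t X"
    by (simp add: algebra_simps)
qed

text \<open>Method of characteristics for \<open>F_t = F \<cdot> \<theta>F\<close>, carried out on formal power series
  (\<open>\<theta> = z d/dz\<close>): both sides are transported by \<open>F\<close> and agree at time 0.\<close>

lemma transported_fixed_point:
  assumes F: "transported F {0..T} F" and F0: "\<And>s. fps_nth (F s) 0 = 0"
    and "finite K" and init: "F 0 = (\<Sum>j\<in>K. fps_const (c j) * fps_X ^ j)" and t: "t \<in> {0..T}"
  shows "F t = (\<Sum>j\<in>K. fps_const (c j) * (fps_X * (fps_exp t oo F t)) ^ j)"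
proof -
  define G where "G s = F s - (\<Sum>j\<in>K. fps_const (c j) * (fps_X * (fps_exp s oo F s)) ^ j)" for s
  have "transported F {0..T} G"
    unfolding G_def
    by (intro transported_diff transported_sum transported_mult transported_const transported_power
        transported_X_exp F F0 \<open>finite K\<close>)
  moreover have "G 0 = 0" by (simp add: G_def init)
  ultimately have "G t = 0" by (rule transported_zero[OF _ F0 _ t])
  then show ?thesis by (simp add: G_def)
qed

section \<open>Evaluating power series with nonnegative coefficients\<close>

definition nonneg_eval :: "real fps \<Rightarrow> real \<Rightarrow> real \<Rightarrow> bool" where
  "nonneg_eval f z s \<longleftrightarrow> (\<forall>k. fps_nth f k \<ge> 0) \<and> (\<lambda>k. fps_nth f k * z ^ k) sums s"

lemma nonneg_eval_monom:
  assumes "c \<ge> 0"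
  shows "nonneg_eval (fps_const c * fps_X ^ j) z (c * z ^ j)"
proof -
  have "(\<lambda>k. fps_nth (fps_const c * fps_X ^ j) k * z ^ k) = (\<lambda>k. if k = j then c * z ^ k else 0)"
    by (auto simp: fps_X_power_nth)
  then show ?thesis
    using assms sums_single[of j "\<lambda>k. c * z ^ k"] by (simp add: nonneg_eval_def fps_X_power_nth)
qed

text \<open>Nonnegative coefficients make convergence at \<open>z\<close> absolute, so the Cauchy
  product is legitimate even on the circle of convergence.\<close>

lemma nonneg_eval_mult:
  assumes f: "nonneg_eval f z s" and g: "nonneg_eval g z r" and z: "z \<ge> 0"
  shows "nonneg_eval (f * g) z (s * r)"
proof -
  have "summable (\<lambda>k. norm (fps_nth f k * z ^ k))" "summable (\<lambda>k. norm (fps_nth g k * z ^ k))"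
    using f g z by (auto simp: nonneg_eval_def sums_iff)
  from Cauchy_product_sums[OF this]
  have "(\<lambda>k. \<Sum>i\<le>k. fps_nth f i * z ^ i * (fps_nth g (k - i) * z ^ (k - i))) sums (s * r)"
    using f g by (simp add: nonneg_eval_def sums_iff)
  moreover have "(\<Sum>i\<le>k. fps_nth f i * z ^ i * (fps_nth g (k - i) * z ^ (k - i))) = fps_nth (f * g) k * z ^ k" for k
    unfolding fps_mult_nth sum_distrib_right atMost_atLeast0
  proof (rule sum.cong[OF refl])
    fix i assume "i \<in> {0..k}"
    then have "z ^ k = z ^ i * z ^ (k - i)" by (simp flip: power_add)
    then show "fps_nth f i * z ^ i * (fps_nth g (k - i) * z ^ (k - i)) = fps_nth f i * fps_nth g (k - i) * z ^ k"
      by simp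
  qed
  moreover have "fps_nth (f * g) k \<ge> 0" for k
    using f g by (auto simp: nonneg_eval_def fps_mult_nth intro!: sum_nonneg)
  ultimately show ?thesis by (simp add: nonneg_eval_def)
qed

lemma nonneg_eval_power:
  assumes "nonneg_eval f z s" "z \<ge> 0"
  shows "nonneg_eval (f ^ n) z (s ^ n)"
proof (induction n)
  case 0
  show ?case using nonneg_eval_monom[of 1 0 z] by simp
next
  case (Suc n)
  show ?case using nonneg_eval_mult[OF assms(1) Suc assms(2)] by simp
qed

lemma nonneg_eval_sum:
  assumes "\<And>i. i \<in> I \<Longrightarrow> nonneg_eval (f i) z (s i)"
  shows "nonneg_eval (\<Sum>i\<in>I. f i) z (\<Sum>i\<in>I. s i)"
proof -
  have "(\<lambda>k. \<Sum>i\<in>I. fps_nth (f i) k * z ^ k) sums (\<Sum>i\<in>I. s i)"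
    using assms by (intro sums_sum) (simp add: nonneg_eval_def)
  then show ?thesis
    using assms by (auto simp: nonneg_eval_def fps_sum_nth sum_distrib_right intro!: sum_nonneg)
qed

text \<open>Tonelli for a nonnegative double series: row \<open>n\<close> sums to a term of the
  exponential series of \<open>t * s\<close>, column \<open>k\<close> to the term of degree
  \<open>k\<close> of the composition. Columns are finite because \<open>f ^ n\<close> starts at
  degree \<open>n\<close> or later.\<close>

lemma nonneg_eval_exp:
  assumes f: "nonneg_eval f z s" and f0: "fps_nth f 0 = 0" and "z \<ge> 0" "t \<ge> 0"
  shows "nonneg_eval (fps_exp t oo f) z (exp (t * s))"
proof -
  define g where "g = (\<lambda>(n, k). t ^ n / fact n * (fps_nth (f ^ n) k * z ^ k))"
  have pow: "nonneg_eval (f ^ n) z (s ^ n)" for n using nonneg_eval_power[OF f \<open>z \<ge> 0\<close>] .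
  have g_nonneg: "g x \<ge> 0" for x
    using pow \<open>z \<ge> 0\<close> \<open>t \<ge> 0\<close> by (auto simp: g_def nonneg_eval_def split: prod.split)
  have "s \<ge> 0"
    using f \<open>z \<ge> 0\<close> by (auto simp: nonneg_eval_def sums_iff intro!: suminf_nonneg)
  have row: "((\<lambda>k. g (n, k)) has_sum t ^ n / fact n * s ^ n) UNIV" for n
    using pow[of n] sums_mult[of "\<lambda>k. fps_nth (f ^ n) k * z ^ k" "s ^ n" "t ^ n / fact n"]
    by (intro sums_nonneg_imp_has_sum g_nonneg) (simp_all add: g_def nonneg_eval_def)
  have "(\<lambda>n. t ^ n / fact n * s ^ n) sums exp (t * s)"
    using exp_converges[of "t * s"] by (simp add: power_mult_distrib divide_inverse mult_ac)
  then have rows: "((\<lambda>n. t ^ n / fact n * s ^ n) has_sum exp (t * s)) UNIV"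
    using \<open>t \<ge> 0\<close> \<open>s \<ge> 0\<close> by (intro sums_nonneg_imp_has_sum) auto
  have "g summable_on UNIV \<times> UNIV"
    by (rule summable_on_SigmaI[OF row]) (use rows g_nonneg in \<open>auto intro: has_sum_imp_summable\<close>)
  then have "(g has_sum exp (t * s)) (UNIV \<times> UNIV)"
    by (intro has_sum_SigmaI[OF row rows])
  then have swapped: "((\<lambda>(k, n). g (n, k)) has_sum exp (t * s)) (UNIV \<times> UNIV)"
    by (subst has_sum_swap) simp
  have col: "((\<lambda>n. (\<lambda>(k, n). g (n, k)) (k, n)) has_sum fps_nth (fps_exp t oo f) k * z ^ k) UNIV" for k
  proof -
    have "((\<lambda>n. g (n, k)) has_sum (\<Sum>n\<le>k. g (n, k))) UNIV"
      using startsby_zero_power_prefix[OF f0]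
      by (intro has_sum_finite_neutralI) (auto simp: g_def)
    then show ?thesis
      by (simp add: g_def fps_compose_nth atMost_atLeast0 sum_distrib_right mult.assoc)
  qed
  have "((\<lambda>k. fps_nth (fps_exp t oo f) k * z ^ k) has_sum exp (t * s)) UNIV"
    by (rule has_sum_SigmaD[OF swapped col])
  moreover have "fps_nth (fps_exp t oo f) k \<ge> 0" for k
    using pow \<open>t \<ge> 0\<close> by (auto simp: fps_compose_nth nonneg_eval_def intro!: sum_nonneg)
  ultimately show ?thesis by (simp add: nonneg_eval_def has_sum_imp_sums)
qed

subsection \<open>Characteristics and the caustic\<close>

text \<open>On a grid of mesh \<open>d\<close> the errors telescope to
  \<open>d * (f a - f b)\<close>, which tends to 0 with the mesh; only the end values of
  \<open>f\<close> enter.\<close>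

lemma telescoping_antimono:
  fixes D f :: "real \<Rightarrow> real"
  assumes "a \<le> b"
    and step: "\<And>s t. a \<le> s \<Longrightarrow> s \<le> t \<Longrightarrow> t \<le> b \<Longrightarrow> D t - D s \<le> (t - s) * (f s - f t)"
  shows "D b \<le> D a"
proof (rule ccontr)
  assume "\<not> D b \<le> D a"
  then have e: "D b - D a > 0" by simp
  obtain n where n: "real n > (b - a) * (f a - f b) / (D b - D a)"
    using reals_Archimedean2 by blast
  define d where "d = (b - a) / real (Suc n)"
  have d: "d \<ge> 0" "real (Suc n) * d = b - a" using \<open>a \<le> b\<close> by (auto simp: d_def)
  have "D (a + real i * d) - D a \<le> d * (f a - f (a + real i * d))" if "i \<le> Suc n" for i
    using that
  proof (induction i)
    case (Suc i)
    have "real (Suc i) * d \<le> real (Suc n) * d"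
      using Suc.prems d(1) by (intro mult_right_mono) auto
    moreover have "0 \<le> real i * d" "real i * d \<le> real (Suc i) * d" using d(1) by (auto intro: mult_right_mono)
    ultimately have "D (a + real (Suc i) * d) - D (a + real i * d) \<le>
        d * (f (a + real i * d) - f (a + real (Suc i) * d))"
      using step[of "a + real i * d" "a + real (Suc i) * d"] d(2) by (simp add: algebra_simps)
    then show ?case using Suc by (simp add: algebra_simps)
  qed simp
  from this[of "Suc n"] have "D b - D a \<le> d * (f a - f b)" by (simp only: d(2)) simp
  then have "real (Suc n) * (D b - D a) \<le> real (Suc n) * (d * (f a - f b))"
    by (intro mult_left_mono) auto
  also have "\<dots> = (b - a) * (f a - f b)" by (simp only: d(2) mult.assoc[symmetric])
  finally have "real (Suc n) * (D b - D a) \<le> (b - a) * (f a - f b)" .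
  moreover have "(b - a) * (f a - f b) < real n * (D b - D a)"
    using n e by (simp add: pos_divide_less_eq)
  ultimately show False using e by (simp add: algebra_simps)
qed

section \<open>Laplace sums of nonnegative sequences\<close>

definition lap_summable :: "(nat \<Rightarrow> real) \<Rightarrow> real \<Rightarrow> bool" where
  "lap_summable u x \<longleftrightarrow> summable (\<lambda>k. u (Suc k) * exp (- real (Suc k) * x))"

definition lap :: "(nat \<Rightarrow> real) \<Rightarrow> real \<Rightarrow> real" where
  "lap u x = (\<Sum>k. u (Suc k) * exp (- real (Suc k) * x))"

lemma lap_mono:
  assumes u: "\<And>k. k \<ge> 1 \<Longrightarrow> u k \<ge> 0" and sum: "lap_summable u x" and "x \<le> y"
  shows "lap_summable u y" "lap u y \<le> lap u x"
proof -
  have le: "u (Suc k) * exp (- real (Suc k) * y) \<le> u (Suc k) * exp (- real (Suc k) * x)" for k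
    using u \<open>x \<le> y\<close> by (intro mult_left_mono) (auto intro: mult_left_mono)
  show 1: "lap_summable u y"
    unfolding lap_summable_def
    by (rule summable_comparison_test'[OF sum[unfolded lap_summable_def], of 0])
      (use le u in \<open>auto simp: abs_mult\<close>)
  show "lap u y \<le> lap u x"
    unfolding lap_def using le 1 sum by (intro suminf_le) (auto simp: lap_summable_def)
qed

text \<open>Weierstrass test with the terms at \<open>x\<close> as majorant; continuity thus reaches
  \<open>x\<close> itself, even if it is the abscissa of convergence.\<close>

lemma continuous_on_lap:
  assumes u: "\<And>k. k \<ge> 1 \<Longrightarrow> u k \<ge> 0" and sum: "lap_summable u x"
  shows "continuous_on {x..} (lap u)"
proof -
  have "uniform_limit {x..} (\<lambda>n y. \<Sum>k<n. u (Suc k) * exp (- real (Suc k) * y)) (lap u) sequentially"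
    unfolding lap_def
  proof (rule Weierstrass_m_test)
    fix n y assume "y \<in> {x..}"
    then have "u (Suc n) * exp (- real (Suc n) * y) \<le> u (Suc n) * exp (- real (Suc n) * x)"
      using u by (intro mult_left_mono) (auto intro: mult_left_mono)
    then show "norm (u (Suc n) * exp (- real (Suc n) * y)) \<le> u (Suc n) * exp (- real (Suc n) * x)"
      using u by (simp add: abs_mult)
  qed (use sum in \<open>simp add: lap_summable_def\<close>)
  then show ?thesis
    by (rule uniform_limit_theorem[rotated]) (auto intro!: always_eventually continuous_intros)
qed

section \<open>Rays issuing from a finitely supported initial state\<close>

locale finite_spectrum =
  fixes K :: "nat set" and c :: "nat \<Rightarrow> real"
  assumes fin: "finite K" and ne: "K \<noteq> {}" and pos: "\<And>j. j \<in> K \<Longrightarrow> j \<ge> 1 \<and> c j > 0"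
begin

text \<open>\<open>W0\<close> is the Laplace sum of the initial state and \<open>W1\<close> is minus
  its derivative, so \<open>W1 0\<close> is the first moment and \<open>1 / W1 0\<close> the
  gelation time.\<close>

definition W0 :: "real \<Rightarrow> real" where "W0 y = (\<Sum>j\<in>K. c j * exp (- real j * y))"
definition W1 :: "real \<Rightarrow> real" where "W1 y = (\<Sum>j\<in>K. real j * c j * exp (- real j * y))"

text \<open>The foot \<open>q\<close> of a characteristic of the inviscid Burgers equation is mapped to its
  position at time \<open>t\<close>.\<close>

definition ray :: "real \<Rightarrow> real \<Rightarrow> real" where "ray t q = q + t * W0 q"

lemma W0_antimono: "x \<le> y \<Longrightarrow> W0 y \<le> W0 x"
  unfolding W0_def using pos
  by (intro sum_mono mult_left_mono) (auto simp: less_imp_le intro: mult_left_mono)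

text \<open>Convexity: termwise, \<open>exp x \<ge> 1 + x\<close> puts \<open>W0\<close> above its
  tangent at \<open>p\<close>, whose slope is \<open>- W1 p\<close>.\<close>

lemma W0_tangent: "W0 q \<ge> W0 p - (q - p) * W1 p"
proof -
  have "c j * exp (- real j * q) \<ge> c j * exp (- real j * p) - (q - p) * (real j * c j * exp (- real j * p))"
    if "j \<in> K" for j
  proof -
    have "exp (- real j * q) = exp (- real j * p) * exp (- real j * (q - p))"
      by (simp add: exp_add[symmetric] algebra_simps)
    moreover have "exp (- real j * (q - p)) \<ge> 1 + - real j * (q - p)" by (rule exp_ge_add_one_self)
    ultimately have "exp (- real j * q) \<ge> exp (- real j * p) * (1 + - real j * (q - p))"
      by simp
    then have "c j * exp (- real j * q) \<ge> c j * (exp (- real j * p) * (1 + - real j * (q - p)))"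
      using pos[OF that] by (intro mult_left_mono) auto
    then show ?thesis by (simp add: algebra_simps)
  qed
  then show ?thesis
    unfolding W0_def W1_def sum_distrib_left sum_subtractf[symmetric] by (intro sum_mono)
qed

lemma W1_pos: "W1 y > 0"
  unfolding W1_def
proof (rule sum_pos[OF fin ne])
  fix j assume "j \<in> K"
  then show "0 < real j * c j * exp (- real j * y)" using pos[of j] by simp
qed

text \<open>The first condition makes \<open>p\<close> a stationary point of the convex function
  \<open>ray t\<close>.\<close>

lemma ray_minimum:
  assumes "t * W1 p = 1" "t \<ge> 0"
  shows "ray t p \<le> ray t q"
proof -
  have "t * (W0 p - (q - p) * W1 p) \<le> t * W0 q"
    using W0_tangent assms(2) by (rule mult_left_mono)
  moreover have "t * (W0 p - (q - p) * W1 p) = t * W0 p - (q - p) * (t * W1 p)"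
    by (simp add: algebra_simps)
  ultimately show ?thesis unfolding assms(1) ray_def by simp
qed

lemma critical_foot_exists:
  assumes t: "t \<ge> 1 / W1 0"
  shows "\<exists>y. t * W1 y = 1"
proof -
  have "t > 0" using t W1_pos[of 0] by (smt (verit) zero_less_divide_1_iff)
  have tW: "t * W1 0 \<ge> 1" using t W1_pos[of 0] by (simp add: pos_divide_le_eq)
  \<comment> \<open>Chosen so that the bound \<open>t * W1 0 * exp (- y)\<close> equals 1.\<close>
  define y where "y = ln (t * W1 0)"
  have "y \<ge> 0" using tW by (simp add: y_def)
  have "W1 y \<le> (\<Sum>j\<in>K. real j * c j * exp (- real j * 0) * exp (- y))"
    unfolding W1_def
  proof (rule sum_mono)
    fix j assume j: "j \<in> K"
    have "1 * y \<le> real j * y" using pos[OF j] \<open>y \<ge> 0\<close> by (intro mult_right_mono) auto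
    then show "real j * c j * exp (- real j * y) \<le> real j * c j * exp (- real j * 0) * exp (- y)"
      using pos[OF j] by (auto intro!: mult_left_mono)
  qed
  then have "W1 y \<le> W1 0 * exp (- y)" by (simp add: W1_def sum_distrib_right)
  then have "t * W1 y \<le> t * W1 0 * exp (- y)" using \<open>t > 0\<close> by simp
  also have "\<dots> = 1" using \<open>t > 0\<close> W1_pos[of 0] by (simp add: y_def exp_minus field_simps)
  finally have "t * W1 y \<le> 1" .
  moreover have "continuous_on {0..y} (\<lambda>y. t * W1 y)"
    unfolding W1_def by (intro continuous_intros)
  ultimately show ?thesis using IVT2'[of "\<lambda>y. t * W1 y" y 1 0] tW \<open>y \<ge> 0\<close> by auto
qed

text \<open>The foot \<open>y - t * lap u y\<close> moves continuously and to infinity with \<open>y\<close>, and it is determined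
  by \<open>y\<close>; it cannot cross the critical point \<open>p\<close>, because \<open>ray t\<close> attains its minimum there.\<close>

lemma foot_ge_critical:
  assumes u: "\<And>k. k \<ge> 1 \<Longrightarrow> u k \<ge> 0" and sum: "lap_summable u a" and "t \<ge> 0" and p: "t * W1 p = 1"
    and foot: "\<And>y. y \<ge> a \<Longrightarrow> W0 (y - t * lap u y) = lap u y"
  shows "p \<le> a - t * lap u a"
proof (rule ccontr)
  assume "\<not> ?thesis"
  then have less: "a - t * lap u a < p" by simp
  have inv: "ray t (y - t * lap u y) = y" if "y \<ge> a" for y
    using foot[OF that] by (simp add: ray_def)
  \<comment> \<open>Far enough to the right that the foot of \<open>b\<close> is at least
    \<open>p\<close>, as \<open>lap u\<close> decreases.\<close>
  define b where "b = max a (p + t * lap u a)"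
  have "t * lap u b \<le> t * lap u a"
    using lap_mono[OF u sum, of b] \<open>t \<ge> 0\<close> by (auto simp: b_def intro: mult_left_mono)
  then have "p \<le> b - t * lap u b" by (simp add: b_def)
  moreover have "continuous_on {a..b} (\<lambda>y. y - t * lap u y)"
    using continuous_on_lap[OF u sum] by (intro continuous_intros) (auto intro: continuous_on_subset)
  ultimately obtain y where y: "a \<le> y" "y - t * lap u y = p"
    using IVT'[of "\<lambda>y. y - t * lap u y" a p b] less by (auto simp: b_def)
  have "y \<noteq> a" using y less by auto
  \<comment> \<open>The point \<open>y\<close> has foot \<open>p\<close>, so it is the minimum of
    \<open>ray t\<close>, of which \<open>a\<close> is also a value.\<close>
  moreover have "y \<le> a"
    using ray_minimum[OF p \<open>t \<ge> 0\<close>, of "a - t * lap u a"] inv[of y] inv[of a] y by simp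
  ultimately show False using y by simp
qed

text \<open>After gelation \<open>a\<close> stays on the caustic \<open>min\<^sub>q ray t q\<close>: it is never below it, it is not
  above it at the gelation time, and from then on it cannot grow faster than the caustic.\<close>

lemma critical_le_ray:
  fixes w :: "real \<Rightarrow> nat \<Rightarrow> real" and a :: "real \<Rightarrow> real"
  assumes w: "\<And>t k. t \<ge> 0 \<Longrightarrow> k \<ge> 1 \<Longrightarrow> w t k \<ge> 0"
    and sum: "\<And>t. t \<ge> 0 \<Longrightarrow> lap_summable (w t) (a t)"
    and foot: "\<And>t y. t \<ge> 0 \<Longrightarrow> lap_summable (w t) y \<Longrightarrow> W0 (y - t * lap (w t) y) = lap (w t) y"
    and a0: "a 0 = 0"
    and growth: "\<And>s t. 0 \<le> s \<Longrightarrow> s \<le> t \<Longrightarrow> a t - a s \<le> (t - s) * lap (w s) (a s)"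
    and T: "T \<ge> 1 / W1 0"
  shows "a T \<le> ray T q"
proof -
  define G where "G = 1 / W1 0"
  have G: "G > 0" "G * W1 0 = 1" using W1_pos[of 0] by (auto simp: G_def)
  \<comment> \<open>Any choice of critical foot will do: the telescoping argument asks for no
    regularity in \<open>t\<close>.\<close>
  define Y where "Y t = (SOME y. t * W1 y = 1)" for t
  have Y: "t * W1 (Y t) = 1" if "t \<ge> G" for t
    using someI_ex[OF critical_foot_exists[of t]] that by (simp add: Y_def G_def)
  have "a T - ray T (Y T) \<le> a G - ray G (Y G)"
  proof (rule telescoping_antimono[where f = "\<lambda>t. W0 (Y t)" and D = "\<lambda>t. a t - ray t (Y t)"])
    fix s t assume st: "G \<le> s" "s \<le> t"
    then have "s \<ge> 0" using G by simp
    have "a t - a s \<le> (t - s) * lap (w s) (a s)" using growth st \<open>s \<ge> 0\<close> by simp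
    \<comment> \<open>The foot of \<open>a s\<close> is not left of \<open>Y s\<close>, so from
      \<open>s\<close> on \<open>a\<close> grows at most at the rate
      \<open>W0 (Y s)\<close>.\<close>
    also have "Y s \<le> a s - s * lap (w s) (a s)"
      using \<open>s \<ge> 0\<close> Y[OF st(1)]
      by (intro foot_ge_critical w sum foot) (auto intro: lap_mono(1)[OF w sum])
    then have "lap (w s) (a s) \<le> W0 (Y s)"
      using W0_antimono foot[OF \<open>s \<ge> 0\<close> sum[OF \<open>s \<ge> 0\<close>]] by metis
    then have "(t - s) * lap (w s) (a s) \<le> (t - s) * W0 (Y s)"
      using st by (intro mult_left_mono) auto
    finally have "a t - a s \<le> (t - s) * W0 (Y s)" .
    \<comment> \<open>Envelope argument: \<open>Y s\<close> is optimal at time \<open>s\<close>, so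
      the caustic gains at least \<open>(t - s) * W0 (Y t)\<close> from \<open>s\<close> to
      \<open>t\<close>.\<close>
    moreover have "ray s (Y s) \<le> ray s (Y t)"
      using Y[OF st(1)] \<open>s \<ge> 0\<close> by (rule ray_minimum)
    ultimately show "a t - ray t (Y t) - (a s - ray s (Y s)) \<le> (t - s) * (W0 (Y s) - W0 (Y t))"
      by (simp add: ray_def algebra_simps)
  qed (use T in \<open>simp add: G_def\<close>)
  \<comment> \<open>At the gelation time \<open>ray G\<close> has its minimum at 0, and
    \<open>a G \<le> G * W0 0 = ray G 0\<close>; hence the difference starts nonpositive.\<close>
  moreover have "a G \<le> G * lap (w 0) 0" using growth[of 0 G] G a0 by simp
  moreover have "lap (w 0) 0 = W0 0" using foot[of 0 0] sum[of 0] a0 by simp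
  moreover have "ray G 0 \<le> ray G (Y G)" using G by (intro ray_minimum) auto
  moreover have "ray T (Y T) \<le> ray T q"
    using T G(1) by (intro ray_minimum Y) (simp_all add: G_def[symmetric])
  ultimately show ?thesis by (simp add: ray_def)
qed

text \<open>The generating series of the flow satisfies the formal fixed-point identity. Nonnegative
  coefficients allow both sides to be evaluated at exp(-y) wherever the series converges, the
  abscissa included.\<close>

lemma flow_foot:
  assumes h: "\<And>T. coag_flow S 0 T h" and S: "countable S"
    and nonneg: "\<And>t k. t \<ge> 0 \<Longrightarrow> k \<ge> 1 \<Longrightarrow> h t k \<ge> 0"
    and init: "\<And>k. k \<ge> 1 \<Longrightarrow> h 0 k = (if k \<in> K then c k else 0)"
    and "t \<ge> 0" and sum: "lap_summable (h t) y"
  shows "W0 (y - t * lap (h t) y) = lap (h t) y"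
proof -
  \<comment> \<open>The value \<open>h s 0\<close> is meaningless; composition with the exponential
    calls for a zero constant term.\<close>
  define F where "F s = Abs_fps (\<lambda>k. if k = 0 then 0 else h s k)" for s
  have F0: "fps_nth (F s) 0 = 0" for s by (simp add: F_def)
  \<comment> \<open>Because \<open>theta (F * F) = 2 * F * theta F\<close>, the factor
    \<open>k / 2\<close> in \<open>coag\<close> yields exactly \<open>F * theta F\<close>.\<close>
  have coag: "coag (h s) k = fps_nth (F s * theta (F s)) k" if "k \<ge> 1" for s k
  proof -
    have "(\<Sum>l=1..k-1. h s l * h s (k - l)) = fps_nth (F s * F s) k"
      unfolding fps_mult_nth by (rule sum.mono_neutral_cong_left) (auto simp: F_def)
    moreover have "real k * fps_nth (F s * F s) k = 2 * fps_nth (F s * theta (F s)) k"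
      unfolding theta_nth[symmetric] theta_mult by (simp add: mult.commute)
    ultimately show ?thesis by (simp add: coag_def)
  qed
  have F: "transported F {0..t} F"
    unfolding transported_def fps_curve_deriv_def
  proof (intro ballI allI)
    fix s k assume s: "s \<in> {0..t}"
    show "((\<lambda>s. fps_nth (F s) k) has_real_derivative fps_nth (F s * theta (F s)) k) (at s within {0..t})"
    proof (cases "k = 0")
      case False
      then show ?thesis
        using coag_flow_deriv_within[OF h S s, of k] coag[of k s] by (simp add: F_def)
    qed (simp add: F_def theta_nth)
  qed
  have "F 0 = (\<Sum>j\<in>K. fps_const (c j) * fps_X ^ j)"
  proof (rule fps_ext)
    fix k
    have "fps_nth (\<Sum>j\<in>K. fps_const (c j) * fps_X ^ j) k = (\<Sum>j\<in>K. if k = j then c j else 0)"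
      unfolding fps_sum_nth by (intro sum.cong refl) (simp add: fps_X_power_nth)
    also have "\<dots> = (if k \<in> K then c k else 0)" using fin by simp
    finally show "fps_nth (F 0) k = fps_nth (\<Sum>j\<in>K. fps_const (c j) * fps_X ^ j) k"
      using init[of k] pos[of 0] by (cases "k = 0") (auto simp: F_def)
  qed
  from transported_fixed_point[OF F F0 fin this, of t] \<open>t \<ge> 0\<close>
  have fixed: "F t = (\<Sum>j\<in>K. fps_const (c j) * (fps_X * (fps_exp t oo F t)) ^ j)" by simp
  define M where "M = lap (h t) y"
  define z where "z = exp (- y)"
  have z: "z \<ge> 0" "exp (- real k * y) = z ^ k" for k
    by (simp_all add: z_def exp_of_nat_mult[symmetric])
  have "(\<lambda>k. h t (Suc k) * exp (- real (Suc k) * y)) sums M"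
    using sum summable_sums unfolding lap_summable_def M_def lap_def by blast
  then have "(\<lambda>k. fps_nth (F t) (Suc k) * z ^ Suc k) sums M"
    unfolding z(2) by (simp add: F_def)
  then have eval: "nonneg_eval (F t) z M"
    using sums_Suc[of "\<lambda>k. fps_nth (F t) k * z ^ k" M] nonneg \<open>t \<ge> 0\<close>
    by (auto simp: nonneg_eval_def F_def)
  have "nonneg_eval (fps_const 1 * fps_X ^ 1) z (1 * z ^ 1)" by (rule nonneg_eval_monom) simp
  then have "nonneg_eval fps_X z z" by simp
  from nonneg_eval_mult[OF this nonneg_eval_exp[OF eval F0 z(1) \<open>t \<ge> 0\<close>] z(1)]
  have u: "nonneg_eval (fps_X * (fps_exp t oo F t)) z (z * exp (t * M))" .
  have "nonneg_eval (fps_const (c j) * (fps_X * (fps_exp t oo F t)) ^ j) z (c j * (z * exp (t * M)) ^ j)"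
    if "j \<in> K" for j
    using nonneg_eval_mult[OF _ nonneg_eval_power[OF u z(1)] z(1), of "fps_const (c j)" "c j" j]
      nonneg_eval_monom[of "c j" 0 z] pos[OF that] by simp
  then have "nonneg_eval (\<Sum>j\<in>K. fps_const (c j) * (fps_X * (fps_exp t oo F t)) ^ j) z
      (\<Sum>j\<in>K. c j * (z * exp (t * M)) ^ j)"
    by (rule nonneg_eval_sum)
  then have "nonneg_eval (F t) z (\<Sum>j\<in>K. c j * (z * exp (t * M)) ^ j)"
    unfolding fixed[symmetric] .
  then have "M = (\<Sum>j\<in>K. c j * (z * exp (t * M)) ^ j)"
    using eval sums_unique2 unfolding nonneg_eval_def by blast
  moreover have "(z * exp (t * M)) ^ j = exp (- real j * (y - t * M))" for j
    unfolding z_def exp_add[symmetric] exp_of_nat_mult[symmetric] by (simp add: algebra_simps)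
  ultimately show ?thesis by (simp add: W0_def M_def)
qed

end

section \<open>Identifying the critical exponent with the abscissa of convergence\<close>

lemma sums_Suc_finite_support:
  fixes g :: "nat \<Rightarrow> real"
  assumes "finite K" "0 \<notin> K" "\<And>k. k \<ge> 1 \<Longrightarrow> k \<notin> K \<Longrightarrow> g k = 0"
  shows "(\<lambda>k. g (Suc k)) sums (\<Sum>j\<in>K. g j)"
proof -
  have "(\<lambda>k. if Suc k \<in> K then g (Suc k) else 0) sums (\<Sum>j\<in>K. g j)"
    using sums_If_finite_set[OF assms(1), of g] assms(2)
      sums_Suc_iff[of "\<lambda>k. if k \<in> K then g k else 0" "\<Sum>j\<in>K. g j"] by simp
  moreover have "(\<lambda>k. if Suc k \<in> K then g (Suc k) else 0) = (\<lambda>k. g (Suc k))"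
    using assms(3) by (auto simp: fun_eq_iff)
  ultimately show ?thesis by simp
qed

theorem theorem6:
  fixes v vt :: "real \<Rightarrow> nat \<Rightarrow> real"
  assumes init: "inNstar (v 0)"
    and sol: "(\<exists>lam c. continuous_on {0..} lam \<and> c > 0 \<and> (\<forall>t\<ge>0. lam t \<ge> c) \<and> subcritical_sol lam v)
            \<or> (\<exists>\<beta>. burning_times \<beta> \<and> alternating_sol \<beta> v)"
    and crit: "critical_sol vt"
    and same_init: "vt 0 = v 0"
  shows "\<forall>t\<ge>1 / m1 (v 0). \<forall>k\<ge>1. vt t k = v t k * exp (- real k * xstar (v t))"
proof -
  have crit': "subcritical_sol (\<lambda>_. 0) vt" using crit by (simp add: critical_sol_def)
  define a where "a t = integral {0..t} (\<lambda>s. m0 (vt s))" for t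
  \<comment> \<open>The reference flow is read off from the critical solution, so convergence of its
    Laplace sum at \<open>a t\<close> is just summability of \<open>vt t\<close>.\<close>
  define h where "h t k = vt t k * exp (real k * a t)" for t k
  obtain S where S: "countable S" and h: "\<And>T. coag_flow S 0 T h"
    using subcritical_flow[OF crit'] unfolding h_def[abs_def] a_def by auto
  have vt: "vt t k = h t k * exp (- real k * a t)" for t k
    by (simp add: h_def exp_minus)
  have a0: "a 0 = 0" by (simp add: a_def)
  have inN: "inN (vt t)" if "t \<ge> 0" for t
    using crit' that by (simp add: subcritical_sol_def)
  have h_nonneg: "h t k \<ge> 0" if "t \<ge> 0" "k \<ge> 1" for t k
    using inN[OF that(1)] that(2) by (simp add: inN_def h_def)
  have h0: "h 0 k = v 0 k" for k by (simp add: h_def a0 same_init)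
  define K where "K = {k. k \<ge> 1 \<and> v 0 k \<noteq> 0}"
  have K: "finite K" "0 \<notin> K" using init by (auto simp: inNstar_def K_def)
  \<comment> \<open>The strict bound on the lost mass, taken at time 0, rules out an empty initial
    state.\<close>
  have "m0 (v 0) > 0"
    using crit' same_init unfolding subcritical_sol_def by (metis order_le_less_trans order_refl)
  moreover have "m0 (v 0) = (\<Sum>j\<in>K. v 0 j)"
    unfolding m0_def using K
    by (intro sums_unique[symmetric] sums_Suc_finite_support) (auto simp: K_def)
  ultimately have "K \<noteq> {}" by auto
  interpret finite_spectrum K "v 0"
    using K \<open>K \<noteq> {}\<close> init by unfold_locales (auto simp: K_def inNstar_def inN_def order_le_less)
  have m1: "m1 (v 0) = W1 0"
  proof -
    have "(\<lambda>k. real (Suc k) * v 0 (Suc k)) sums (\<Sum>j\<in>K. real j * v 0 j)"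
      by (rule sums_Suc_finite_support[OF K]) (simp add: K_def)
    then show ?thesis by (simp add: m1_def W1_def sums_iff)
  qed
  have summand: "h t (Suc k) * exp (- real (Suc k) * a t) = vt t (Suc k)" for t k
    by (simp add: vt)
  have sum: "lap_summable (h t) (a t)" if "t \<ge> 0" for t
    using inN[OF that] unfolding lap_summable_def summand by (simp add: inN_def)
  have lap: "lap (h t) (a t) = m0 (vt t)" for t
    unfolding lap_def summand by (simp add: m0_def)
  have foot: "W0 (y - t * lap (h t) y) = lap (h t) y" if "t \<ge> 0" "lap_summable (h t) y" for t y
    by (rule flow_foot[OF h S h_nonneg _ that]) (auto simp: h0 K_def)
  have m0_antimono: "m0 (vt r) \<le> m0 (vt s)" if "0 \<le> s" "s \<le> r" for s r
    using crit' that unfolding subcritical_sol_def mono_on_def by fastforce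
  have m0_int: "(\<lambda>s. m0 (vt s)) integrable_on {s..t}" if "0 \<le> s" for s t
  proof -
    have "(\<lambda>s. - m0 (vt s)) integrable_on {s..t}"
      using m0_antimono that by (intro integrable_on_mono_on) (auto simp: mono_on_def)
    then show ?thesis using integrable_neg_iff[of "\<lambda>s. m0 (vt s)"] by blast
  qed
  have growth: "a t - a s \<le> (t - s) * lap (h s) (a s)" if "0 \<le> s" "s \<le> t" for s t
  proof -
    have "a t - a s = integral {s..t} (\<lambda>r. m0 (vt r))"
      using Henstock_Kurzweil_Integration.integral_combine[OF that m0_int[of 0 t]] by (simp add: a_def)
    also have "\<dots> \<le> integral {s..t} (\<lambda>r. m0 (vt s))"
      using that m0_antimono by (intro integral_le m0_int) auto
    finally show ?thesis using that by (simp add: lap)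
  qed
  have same: "\<exists>b. \<forall>k\<ge>1. v t k = h t k * exp (- real k * b)" if "t \<ge> 0" for t
    using sol
  proof (elim disjE exE conjE)
    fix lam assume lam: "continuous_on {0..} lam" and sub: "subcritical_sol lam v"
    define A where "A t = integral {0..t} (\<lambda>s. m0 (v s) + lam s)" for t
    obtain S' where S': "countable S'" and g: "\<And>T. coag_flow S' 0 T (\<lambda>t k. v t k * exp (real k * A t))"
      using subcritical_flow[OF sub lam] unfolding A_def by auto
    have "v t k * exp (real k * A t) = h t k" if "k \<ge> 1" for k
      using coag_flow_unique[OF g[of t] h[of t] S' S, of t k] that \<open>t \<ge> 0\<close> by (simp add: h0 A_def)
    then have "v t k = h t k * exp (- real k * A t)" if "k \<ge> 1" for k
      using that by (metis exp_minus_inverse mult.assoc mult.right_neutral mult_minus_left)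
    then show ?thesis by blast
  next
    fix \<beta> assume "burning_times \<beta>" "alternating_sol \<beta> v"
    then show ?thesis using alternating_flow[OF _ _ h S _ that] h0 by blast
  qed
  show ?thesis
  proof (intro allI impI)
    fix t :: real and k :: nat assume t: "t \<ge> 1 / m1 (v 0)" and k: "k \<ge> 1"
    have "1 / m1 (v 0) > 0" using W1_pos[of 0] by (simp add: m1)
    then have "t \<ge> 0" using t by linarith
    obtain b where b: "\<And>k. k \<ge> 1 \<Longrightarrow> v t k = h t k * exp (- real k * b)"
      using same[OF \<open>t \<ge> 0\<close>] by blast
    \<comment> \<open>Passing from \<open>h t\<close> to \<open>v t\<close> shifts the Laplace
      variable by \<open>b\<close>, hence the abscissa by \<open>- b\<close>.\<close>
    have shift: "v t (Suc k) * exp (- real (Suc k) * x) = h t (Suc k) * exp (- real (Suc k) * (b + x))" for k x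
      by (simp add: b exp_add[symmetric] mult.assoc) (simp add: algebra_simps)
    have "xstar (v t) = Inf {x. lap_summable (h t) (b + x)}"
      unfolding xstar_def lap_summable_def shift ..
    also have "\<dots> = a t - b"
    \<comment> \<open>The infimum is attained: the Laplace sum of \<open>h t\<close> converges at
      \<open>a t\<close>, and any point where it converges is a value of \<open>ray t\<close>, hence
      at least \<open>a t\<close>.\<close>
    proof (rule cInf_eq_minimum)
      show "a t - b \<in> {x. lap_summable (h t) (b + x)}" using sum[OF \<open>t \<ge> 0\<close>] by simp
      fix x assume "x \<in> {x. lap_summable (h t) (b + x)}"
      then have "ray t (b + x - t * lap (h t) (b + x)) = b + x"
        using foot[OF \<open>t \<ge> 0\<close>] by (simp add: ray_def)
      moreover have "a t \<le> ray t q" for q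
        using t by (intro critical_le_ray[of h a] h_nonneg sum foot a0 growth) (simp_all add: m1)
      ultimately show "a t - b \<le> x" by (metis add.commute diff_le_eq)
    qed
    finally have "xstar (v t) = a t - b" .
    then have "v t k * exp (- real k * xstar (v t)) = h t k * (exp (- real k * b) * exp (- real k * (a t - b)))"
      using b[OF k] by simp
    also have "\<dots> = vt t k" unfolding vt exp_add[symmetric] by (simp add: algebra_simps)
    finally show "vt t k = v t k * exp (- real k * xstar (v t))" by simp
  qed
qed

end
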